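(* For every graph $G$ and every input divisor $D$ on $G$, the Modified Dhar's Burning Algorithm (defined in the context) terminates.
   Context: All graphs are finite, connected, loopless multigraphs with nonempty vertex set $V(G)$. A divisor on $G$ is an element $D=\sum_v D(v)\cdot v$ of the free abelian group on $V(G)$; $D\ge 0$ (effective) means $D(v)\ge 0$ for all $v$. Write $D=D^+-D^-$ with $D^+(v)=\max\{D(v),0\}$, $D^-(v)=\max\{-D(v),0\}$, and let $\mathrm{supp}(D^-)=\{v: D(v)<0\}$. For $W\subseteq V(G)$ and $v\in W$, $\mathrm{outdeg}_W(v)$ is the number of edges from $v$ to $V(G)\setminus W$. Let $\Delta:\mathbb{Z}^{V(G)}\to \mathrm{Div}(G)$ be the map given by the Laplacian matrix (diagonal entries the valences $\mathrm{val}(v)$, off-diagonal entries minus the number of edges between the two vertices), and let $\mathbb{1}_W$ be the indicator function of $W$; replacing $D$ by $D-\Delta\mathbb{1}_W$ is called firing $W$ (one chip is sent along each edge from $W$ to $V(G)\setminus W$). Modified Dhar's Burning Algorithm, on input a divisor $D$: (1) If $D\ge 0$, return $D$. (2) Set $W:=V(G)\setminus\mathrm{supp}(D^-)$. (3) While $W\neq\emptyset$: if there is some $v\in W$ with $D(v)<\mathrm{outdeg}_W(v)$, replace $W$ by $W\setminus\{v\}$; otherwise, call the algorithm recursively on $D-\Delta\mathbb{1}_W$ and return its result. (4) If $W=\emptyset$ is reached, return NONE. *)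

theory Defs
  imports "HOL-Library.Multiset" "HOL-Library.Indicator_Function"
begin

text \<open>A multigraph is a vertex set together with a multiset of edges; a (non-loop) edge is the
  two-element set of its end points, so \<^term>\<open>count E {u, v}\<close> is the number of edges between
  distinct \<^term>\<open>u\<close> and \<^term>\<open>v\<close>.\<close>

locale connected_multigraph =
  fixes V :: "'v set" and E :: "'v set multiset"
  assumes finite_verts: "finite V"
    and verts_nonempty: "V \<noteq> {}"
    and edges_wf: "e \<in># E \<Longrightarrow> e \<subseteq> V \<and> card e = 2"
    and connected: "u \<in> V \<Longrightarrow> v \<in> V \<Longrightarrow> (u, v) \<in> {(x, y). {x, y} \<in># E}\<^sup>*"

text \<open>The free abelian group on the finite set \<^term>\<open>V\<close>, realised as the integer-valued
  functions vanishing outside \<^term>\<open>V\<close>.\<close>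

definition divisors :: "'v set \<Rightarrow> ('v \<Rightarrow> int) set" where
  "divisors V = {D. \<forall>v. v \<notin> V \<longrightarrow> D v = 0}"

definition effective :: "'v set \<Rightarrow> ('v \<Rightarrow> int) \<Rightarrow> bool" where
  "effective V D \<longleftrightarrow> (\<forall>v\<in>V. D v \<ge> 0)"

definition neg_supp :: "'v set \<Rightarrow> ('v \<Rightarrow> int) \<Rightarrow> 'v set" where
  "neg_supp V D = {v \<in> V. D v < 0}"

definition valence :: "'v set multiset \<Rightarrow> 'v \<Rightarrow> nat" where
  "valence E v = size {#e \<in># E. v \<in> e#}"

definition outdeg :: "'v set \<Rightarrow> 'v set multiset \<Rightarrow> 'v set \<Rightarrow> 'v \<Rightarrow> nat" where
  "outdeg V E W v = (\<Sum>w\<in>V - W. count E {v, w})"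

definition laplacian_entry :: "'v set multiset \<Rightarrow> 'v \<Rightarrow> 'v \<Rightarrow> int" where
  "laplacian_entry E v w = (if v = w then int (valence E v) else - int (count E {v, w}))"

definition laplacian :: "'v set \<Rightarrow> 'v set multiset \<Rightarrow> ('v \<Rightarrow> int) \<Rightarrow> ('v \<Rightarrow> int)" where
  "laplacian V E f = (\<lambda>v. if v \<in> V then \<Sum>w\<in>V. laplacian_entry E v w * f w else 0)"

definition fire :: "'v set \<Rightarrow> 'v set multiset \<Rightarrow> 'v set \<Rightarrow> ('v \<Rightarrow> int) \<Rightarrow> ('v \<Rightarrow> int)" where
  "fire V E W D = (\<lambda>v. D v - laplacian V E (indicator W) v)"

text \<open>The algorithm is given by its small-step semantics. In state \<open>Call D\<close> it has just been
  called on \<open>D\<close>; in state \<open>Loop D W\<close> it is about to test the condition of the while loop. Since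
  the recursive call is a tail call, no call stack is needed. The choice of the vertex to be
  removed is nondeterministic.\<close>

datatype 'v dhar_state =
    Call "'v \<Rightarrow> int"
  | Loop "'v \<Rightarrow> int" "'v set"
  | Return "('v \<Rightarrow> int) option"

inductive dhar_step :: "'v set \<Rightarrow> 'v set multiset \<Rightarrow> 'v dhar_state \<Rightarrow> 'v dhar_state \<Rightarrow> bool"
  for V :: "'v set" and E :: "'v set multiset" where
  return_effective:
    "effective V D \<Longrightarrow> dhar_step V E (Call D) (Return (Some D))"
| enter_loop:
    "\<not> effective V D \<Longrightarrow> dhar_step V E (Call D) (Loop D (V - neg_supp V D))"
| burn_vertex:
    "v \<in> W \<Longrightarrow> D v < int (outdeg V E W v) \<Longrightarrow> dhar_step V E (Loop D W) (Loop D (W - {v}))"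
| fire_set:
    "W \<noteq> {} \<Longrightarrow> \<not> (\<exists>v\<in>W. D v < int (outdeg V E W v)) \<Longrightarrow>
     dhar_step V E (Loop D W) (Call (fire V E W D))"
| return_none:
    "dhar_step V E (Loop D {}) (Return None)"

text \<open>Termination is required for all nondeterministic choices: there is no infinite run on
  input \<^term>\<open>D\<close>, and a run that cannot be continued has returned a result rather than being
  stuck.\<close>

definition dhar_terminates :: "'v set \<Rightarrow> 'v set multiset \<Rightarrow> ('v \<Rightarrow> int) \<Rightarrow> bool" where
  "dhar_terminates V E D \<longleftrightarrow>
     \<not> (\<exists>s :: nat \<Rightarrow> 'v dhar_state. s 0 = Call D \<and> (\<forall>i. dhar_step V E (s i) (s (Suc i)))) \<and>
     (\<forall>t. (dhar_step V E)\<^sup>*\<^sup>* (Call D) t \<and> \<not> (\<exists>u. dhar_step V E t u) \<longrightarrow> (\<exists>r. t = Return r))"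

end

theory Submission imports Defs begin

text \<open>Firing a set that survives the burning process keeps the degree and creates no new debt, so
  the debt bounds all divisors of a run from below and, by conservation of the degree, from above.
  An infinite run would thus repeat a divisor. The sum \<open>f\<close> of the indicator functions of the sets
  fired in between would satisfy \<open>\<Delta> f = 0\<close> and vanish at a vertex in debt, which is never fired;
  since \<open>f \<ge> 0\<close>, the equation \<open>\<Delta> f = 0\<close> at a zero of \<open>f\<close> forces \<open>f\<close> to vanish at all its neighbours,
  hence everywhere by connectedness. But only nonempty sets are fired.\<close>

text \<open>What holds whenever the while loop ends with a firing: burning only shrinks
  \<open>W\<close>, so \<open>W\<close> still avoids the debt, and no vertex left in it can
  burn.\<close>

definition legal_firing :: "'v set \<Rightarrow> 'v set multiset \<Rightarrow> ('v \<Rightarrow> int) \<Rightarrow> 'v set \<Rightarrow> bool" where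
  "legal_firing V E D W \<longleftrightarrow>
     W \<noteq> {} \<and> W \<subseteq> V - neg_supp V D \<and> (\<forall>v\<in>W. int (outdeg V E W v) \<le> D v)"

context connected_multigraph
begin

section \<open>The Laplacian and harmonic functions\<close>

lemma valence_eq_sum_count:
  assumes "v \<in> V"
  shows "valence E v = (\<Sum>w\<in>V - {v}. count E {v, w})"
proof -
  \<comment> \<open>Edges are not loops, so each edge at \<open>v\<close> is \<open>{v, w}\<close>
    for exactly one \<open>w \<noteq> v\<close>.\<close>
  let ?S = "{e \<in> set_mset E. v \<in> e}" and ?T = "(\<lambda>w. {v, w}) ` (V - {v})"
  have "?S \<subseteq> ?T"
  proof
    fix e assume e: "e \<in> ?S"
    then have "e \<subseteq> V" "card e = 2" using edges_wf by auto
    then obtain x y where "e = {x, y}" "x \<noteq> y" by (meson card_2_iff)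
    with e \<open>e \<subseteq> V\<close> show "e \<in> ?T" by (auto simp: insert_commute)
  qed
  have "valence E v = (\<Sum>e\<in>?S. count E e)"
    by (simp add: valence_def size_multiset_overloaded_eq)
  also have "\<dots> = (\<Sum>e\<in>?T. count E e)"
    using \<open>?S \<subseteq> ?T\<close> finite_verts by (intro sum.mono_neutral_left) (auto simp: not_in_iff)
  also have "\<dots> = (\<Sum>w\<in>V - {v}. count E {v, w})"
    by (subst sum.reindex) (auto simp: inj_on_def doubleton_eq_iff)
  finally show ?thesis .
qed

text \<open>This form shows the linearity in \<open>f\<close> and makes signs visible; the term
  \<open>w = v\<close> is zero, so the sum may run over all of \<open>V\<close>.\<close>

lemma laplacian_eq_sum_differences:
  assumes "v \<in> V"
  shows "laplacian V E f v = (\<Sum>w\<in>V. int (count E {v, w}) * (f v - f w))"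
proof -
  have "laplacian V E f v = int (valence E v) * f v
      + (\<Sum>w\<in>V - {v}. - int (count E {v, w}) * f w)"
    using assms finite_verts
    by (auto simp: laplacian_def laplacian_entry_def sum.remove[of V v]
        intro!: sum.cong split: if_splits)
  also have "\<dots> = (\<Sum>w\<in>V - {v}. int (count E {v, w}) * (f v - f w))"
    by (simp add: valence_eq_sum_count[OF assms] sum_distrib_right right_diff_distrib
        sum_subtractf sum_negf)
  also have "\<dots> = (\<Sum>w\<in>V. int (count E {v, w}) * (f v - f w))"
    using assms finite_verts by (simp add: sum.remove[of V v])
  finally show ?thesis .
qed

text \<open>Each edge contributes opposite amounts at its two ends, because
  \<open>{v, w} = {w, v}\<close>.\<close>

lemma sum_laplacian: "(\<Sum>v\<in>V. laplacian V E f v) = 0"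
proof -
  let ?c = "\<lambda>v w. int (count E {v, w})"
  have "(\<Sum>v\<in>V. \<Sum>w\<in>V. ?c v w * f w) = (\<Sum>v\<in>V. \<Sum>w\<in>V. ?c v w * f v)"
    by (subst sum.swap) (simp add: insert_commute)
  then show ?thesis
    by (simp add: laplacian_eq_sum_differences right_diff_distrib sum_subtractf)
qed

lemma laplacian_indicator_inside:
  assumes "W \<subseteq> V" "v \<in> W"
  shows "laplacian V E (indicator W) v = int (outdeg V E W v)"
proof -
  have "laplacian V E (indicator W) v
      = (\<Sum>w\<in>V. int (count E {v, w}) * (1 - indicator W w))"
    using assms by (simp add: laplacian_eq_sum_differences subset_iff)
  also have "\<dots> = (\<Sum>w\<in>V - W. int (count E {v, w}))"
    using finite_verts by (intro sum.mono_neutral_cong_right) (auto simp: indicator_def)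
  finally show ?thesis by (simp add: outdeg_def)
qed

lemma laplacian_indicator_outside:
  assumes "v \<notin> W"
  shows "laplacian V E (indicator W) v \<le> 0"
proof (cases "v \<in> V")
  case True
  then show ?thesis
    using assms
    by (auto simp: laplacian_eq_sum_differences intro!: sum_nonpos mult_nonneg_nonpos)
qed (simp add: laplacian_def)

text \<open>A discrete minimum principle: zeros of \<open>f\<close> spread along a path from
  \<open>q\<close> to \<open>v\<close>.\<close>

lemma harmonic_nonneg_eq_zero:
  fixes f :: "'v \<Rightarrow> int"
  assumes harmonic: "\<And>v. v \<in> V \<Longrightarrow> laplacian V E f v = 0"
    and nonneg: "\<And>v. f v \<ge> 0"
    and q: "q \<in> V" "f q = 0"
    and "v \<in> V"
  shows "f v = 0"
proof -
  have "(q, v) \<in> {(x, y). {x, y} \<in># E}\<^sup>*"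
    using connected q \<open>v \<in> V\<close> by blast
  then have "v \<in> V \<and> f v = 0"
  proof (induction rule: rtrancl_induct)
    case base
    show ?case using q by simp
  next
    case (step x y)
    then have xy: "{x, y} \<in># E" and x: "x \<in> V" "f x = 0" by auto
    then have y: "y \<in> V" using edges_wf by blast
    have "(\<Sum>w\<in>V. int (count E {x, w}) * f w) = 0"
      using harmonic[OF x(1)] x by (simp add: laplacian_eq_sum_differences sum_negf)
    then have "int (count E {x, y}) * f y = 0"
      using finite_verts y nonneg by (subst (asm) sum_nonneg_eq_0_iff) auto
    with xy y show ?case by (auto simp: count_eq_zero_iff)
  qed
  then show ?thesis ..
qed

section \<open>Legal firings\<close>

lemma sum_fire: "(\<Sum>v\<in>V. fire V E W D v) = (\<Sum>v\<in>V. D v)"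
  by (simp add: fire_def sum_subtractf sum_laplacian)

lemma fire_in_divisors:
  assumes "D \<in> divisors V"
  shows "fire V E W D \<in> divisors V"
  using assms by (simp add: divisors_def fire_def laplacian_def)

text \<open>A vertex in \<open>W\<close> pays its outdegree, which it can afford, and so stays out
  of debt; any other vertex can only gain chips.\<close>

lemma legal_firing_lower_bound:
  assumes "legal_firing V E D W"
  shows "min (D v) 0 \<le> fire V E W D v"
proof (cases "v \<in> W")
  case True
  moreover have "W \<subseteq> V" using assms by (auto simp: legal_firing_def)
  ultimately show ?thesis
    using assms laplacian_indicator_inside[of W v]
    by (auto simp: legal_firing_def fire_def)
next
  case False
  then show ?thesis
    using laplacian_indicator_outside[of v W] by (simp add: fire_def)
qed

text \<open>The relation between the inputs of successive calls. Only a non-effective input leads to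
  a further call, and its debt supplies the vertex that is never fired.\<close>

lemma wf_legal_firing:
  "wf {(D', D). D \<in> divisors V \<and> \<not> effective V D \<and>
        (\<exists>W. legal_firing V E D W \<and> D' = fire V E W D)}"
  unfolding wf_iff_no_infinite_down_chain
proof
  assume "\<exists>D. \<forall>i. (D (Suc i), D i) \<in> {(D', D). D \<in> divisors V \<and> \<not> effective V D \<and>
        (\<exists>W. legal_firing V E D W \<and> D' = fire V E W D)}"
  then obtain D where div: "\<And>i. D i \<in> divisors V" and neff: "\<And>i. \<not> effective V (D i)"
    and "\<forall>i. \<exists>W. legal_firing V E (D i) W \<and> D (Suc i) = fire V E W (D i)"
    by auto
  then obtain W where legal: "\<And>i. legal_firing V E (D i) (W i)"
    and Suc: "\<And>i. D (Suc i) = fire V E (W i) (D i)"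
    by metis
  have step: "min (D i v) 0 \<le> D (Suc i) v" for i v
    unfolding Suc using legal by (rule legal_firing_lower_bound)
  have mono: "min (D i v) 0 \<le> min (D j v) 0" if "i \<le> j" for i j v
    using that
  proof (induction rule: dec_induct)
    case (step k)
    with \<open>min (D k v) 0 \<le> D (Suc k) v\<close> show ?case by linarith
  qed simp
  \<comment> \<open>\<open>- m\<close> is the initial debt. As \<open>m \<le> 0\<close>, its total
    \<open>M\<close> bounds every \<open>m v\<close> from below, which gives one interval for all
    vertices.\<close>
  define m where "m v = min (D 0 v) 0" for v
  define M where "M = (\<Sum>v\<in>V. m v)"
  define d where "d = (\<Sum>v\<in>V. D 0 v)"
  have degree: "(\<Sum>v\<in>V. D i v) = d" for i
    by (induction i) (simp_all add: d_def Suc sum_fire)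
  have lower: "m v \<le> D i v" for i v
    using mono[of 0 i v] by (simp add: m_def)
  have M_le: "M \<le> m v" if "v \<in> V" for v
  proof -
    have "(\<Sum>u\<in>V - {v}. m u) \<le> 0" by (intro sum_nonpos) (simp add: m_def)
    then show ?thesis using that finite_verts by (simp add: M_def sum.remove[of V v])
  qed
  \<comment> \<open>The vertices other than \<open>v\<close> together hold at least
    \<open>M - m v \<ge> M\<close> of the \<open>d\<close> chips.\<close>
  have upper: "D i v \<le> d - M" if "v \<in> V" for i v
  proof -
    have "(\<Sum>u\<in>V - {v}. m u) \<le> (\<Sum>u\<in>V - {v}. D i u)"
      by (intro sum_mono lower)
    moreover have "m v \<le> 0" by (simp add: m_def)
    ultimately show ?thesis
      using degree[of i] that finite_verts
      by (simp add: M_def sum.remove[of V v])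
  qed
  have "range D \<subseteq> {g. \<forall>v. (v \<in> V \<longrightarrow> g v \<in> {M..d - M}) \<and> (v \<notin> V \<longrightarrow> g v = 0)}"
    using div lower M_le upper by (fastforce simp: divisors_def intro: order_trans)
  moreover have "finite {g. \<forall>v. (v \<in> V \<longrightarrow> g v \<in> {M..d - M}) \<and> (v \<notin> V \<longrightarrow> g v = 0)}"
    by (intro finite_set_of_finite_funs finite_verts) simp
  ultimately have "finite (range D)" by (rule finite_subset)
  then have "\<not> inj D" using finite_imageD infinite_UNIV_nat by blast
  then obtain i j where "i < j" and cycle: "D i = D j"
    unfolding inj_def by (metis linorder_neqE_nat)
  \<comment> \<open>\<open>f\<close> counts how often each vertex fires on the way from
    \<open>D i\<close> to \<open>D j\<close>; the firing of \<open>W j\<close> comes after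
    that.\<close>
  define f :: "'v \<Rightarrow> int" where "f v = (\<Sum>k = i..<j. indicator (W k) v)" for v
  have "D n v = D i v - laplacian V E (\<lambda>v. \<Sum>k = i..<n. indicator (W k) v) v"
    if "i \<le> n" "v \<in> V" for n v
    using that
  proof (induction rule: dec_induct)
    case base
    then show ?case by (simp add: laplacian_eq_sum_differences)
  next
    case (step n)
    then show ?case
      by (simp add: Suc fire_def laplacian_eq_sum_differences algebra_simps sum.distrib
          sum_subtractf)
  qed
  from this[of j] have harmonic: "laplacian V E f v = 0" if "v \<in> V" for v
    using that \<open>i < j\<close> cycle by (simp add: f_def[abs_def])
  \<comment> \<open>The debt is taken at the end of the cycle, since by \<open>mono\<close> a vertex
    in debt at time \<open>j\<close> was in debt at all earlier times.\<close>
  obtain q where q: "q \<in> V" "D j q < 0"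
    using neff[of j] by (auto simp: effective_def not_le)
  have "q \<notin> W k" if "k < j" for k
    using mono[of k j q] that q legal[of k] by (auto simp: legal_firing_def neg_supp_def)
  then have "f q = 0" by (simp add: f_def)
  have "W i \<noteq> {}" "W i \<subseteq> V" using legal[of i] by (auto simp: legal_firing_def)
  then obtain v where v: "v \<in> W i" "v \<in> V" by blast
  have nonneg: "f u \<ge> 0" for u
    unfolding f_def by (intro sum_nonneg) simp
  have "f v = 0"
    using harmonic nonneg q(1) \<open>f q = 0\<close> v(2) by (rule harmonic_nonneg_eq_zero)
  moreover have "f v \<ge> 1"
    using member_le_sum[of i "{i..<j}" "\<lambda>k. indicator (W k) v :: int"] \<open>i < j\<close> v
    by (simp add: f_def)
  ultimately show False by simp
qed

section \<open>Runs of the algorithm\<close>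

lemma Return_termip: "termip (dhar_step V E) (Return r)"
  by (rule accp.accI) (auto elim: dhar_step.cases)

text \<open>Burning shrinks a finite set, and the loop can otherwise only return or fire legally;
  the recursive call is left to the assumption \<open>Call\<close>.\<close>

lemma Loop_termip:
  assumes Call: "\<And>W. legal_firing V E D W \<Longrightarrow>
      termip (dhar_step V E) (Call (fire V E W D))"
    and "W \<subseteq> V - neg_supp V D"
  shows "termip (dhar_step V E) (Loop D W)"
proof -
  have "finite W" using assms(2) finite_verts by (auto intro: finite_subset)
  then show ?thesis
    using assms(2)
  proof (induction W rule: finite_psubset_induct)
    case (psubset W)
    show ?case
    proof (rule accp.accI)
      fix t assume "(dhar_step V E)\<inverse>\<inverse> t (Loop D W)"
      then have "dhar_step V E (Loop D W) t" by simp
      then show "termip (dhar_step V E) t"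
      proof cases
        case (burn_vertex v)
        moreover have "W - {v} \<subset> W" using burn_vertex by blast
        ultimately show ?thesis using psubset by blast
      next
        case fire_set
        then have "legal_firing V E D W"
          using psubset.prems by (auto simp: legal_firing_def not_less)
        then show ?thesis using fire_set Call by simp
      qed (auto intro: Return_termip)
    qed
  qed
qed

lemma Call_termip:
  assumes "D \<in> divisors V"
  shows "termip (dhar_step V E) (Call D)"
  using assms
proof (induction D rule: wf_induct_rule[OF wf_legal_firing])
  case (1 D)
  show ?case
  proof (rule accp.accI)
    fix t assume "(dhar_step V E)\<inverse>\<inverse> t (Call D)"
    then have "dhar_step V E (Call D) t" by simp
    then show "termip (dhar_step V E) t"
    proof cases
      case enter_loop
      have "termip (dhar_step V E) (Call (fire V E W D))" if "legal_firing V E D W" for W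
        using that 1 \<open>\<not> effective V D\<close> fire_in_divisors by blast
      with enter_loop show ?thesis by (simp add: Loop_termip)
    qed (auto intro: Return_termip)
  qed
qed

end

text \<open>The tail of an infinite run is an infinite run from a successor, which the induction
  hypothesis excludes.\<close>

lemma no_infinite_run_if_termip:
  assumes "termip r x"
  shows "\<not> (\<exists>s :: nat \<Rightarrow> 'a. s 0 = x \<and> (\<forall>i. r (s i) (s (Suc i))))"
  using assms
proof (induction rule: accp.induct)
  case (accI x)
  show ?case
  proof
    assume "\<exists>s. s 0 = x \<and> (\<forall>i. r (s i) (s (Suc i)))"
    then obtain s where s: "s 0 = x" "\<And>i. r (s i) (s (Suc i))" by blast
    have "r\<inverse>\<inverse> (s (Suc 0)) x" using s(2)[of 0] s(1) by simp
    from accI.IH[OF this] s(2) show False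
      by (auto dest: spec[where x = "\<lambda>i. s (Suc i)"])
  qed
qed

text \<open>The conditions for burning and firing are complementary when \<open>W\<close> is
  nonempty, and the empty set has its own rule.\<close>

lemma stuck_imp_Return:
  assumes "\<not> (\<exists>u. dhar_step V E t u)"
  shows "\<exists>r. t = Return r"
proof (cases t)
  case (Call D)
  then show ?thesis using assms return_effective enter_loop by metis
next
  case (Loop D W)
  then show ?thesis using assms burn_vertex fire_set return_none by metis
qed simp

theorem proposition6p2:
  fixes V :: "'v set" and E :: "'v set multiset" and D :: "'v \<Rightarrow> int"
  assumes "connected_multigraph V E"
    and "D \<in> divisors V"
  shows "dhar_terminates V E D"
  unfolding dhar_terminates_def
  using no_infinite_run_if_termip[OF connected_multigraph.Call_termip[OF assms]] stuck_imp_Return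
  by blast

end
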